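(* (i) Let $h_1,h_2,l_1,\alpha_1,\lambda\in\mathbb{C}$ and $t_1,t_2\in\mathbb{C}\setminus\{0\}$. The functions $$g_1(x)=x^{-\alpha_1}\sum_{n=0}^\infty(q^{-\lambda-\alpha_1+h_1+1/2}t_1x^{-1})^n(q^{\lambda+\alpha_1};q)_n\sum_{\ell=0}^n\frac{(q^{\lambda+\alpha_1-h_1+l_1};q)_\ell}{(q;q)_{n-\ell}(q;q)_\ell}q^{-\ell(2n-\ell-1)/2}(-q^{-\lambda-\alpha_1-l_1+h_2}t_2/t_1)^\ell,$$ $$g_2(x)=\big((q^{-h_2+1/2}t_2^{-1}x;q)_\infty\big)^{-1}x^{2\lambda+\alpha_1-h_1+l_1-1}\sum_{n=0}^\infty(q^{1/2}x^{-1})^n(q^{-\lambda-\alpha_1+h_1-l_1+1};q)_n\sum_{k=0}^n\frac{(q^{-\lambda-\alpha_1+1};q)_{n-k}}{(q;q)_k(q;q)_{n-k}}(q^{l_1}t_1)^k(q^{h_2}t_2)^{n-k}$$ are formal solutions of $$q^{h_1+h_2-l_1-2\lambda+1/2}t_2(q^{l_1-1/2}t_1-x)g(qx)+(x-q^{h_1+1/2}t_1)(x-q^{h_2+1/2}t_2)g(x/q)$$ $$-\big[q^{\alpha_1}x^2-q^{h_1+h_2-\lambda+1/2}(q^{-h_2}t_1+q^{-h_1}t_2+q^{-l_1}t_2)x+q^{h_1+h_2-\lambda}(q+1)t_1t_2\big]g(x)=0.$$ (ii) Let $h_1,l_1,l_2,\alpha_1,\lambda\in\mathbb{C}$ and $t_1,t_2\in\mathbb{C}\setminus\{0\}$.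 The functions $$g_3(x)=(q^{-l_2+1/2}t_2^{-1}x;q)_\infty\,x^{2\lambda+\alpha_1-h_1+l_1-1}\sum_{n=0}^\infty(q^{\lambda+\alpha_1+l_1-1/2}t_1x^{-1})^n(q^{-\lambda-\alpha_1+h_1-l_1+1};q)_n$$ $$\qquad\cdot\sum_{\ell=0}^n\frac{(q^{-\lambda-\alpha_1+1};q)_\ell}{(q;q)_{n-\ell}(q;q)_\ell}q^{-\ell(2n-\ell-1)/2}(-q^{\lambda+\alpha_1-h_1+l_2-1}t_2/t_1)^\ell,$$ $$g_4(x)=x^{-\alpha_1}\sum_{n=0}^\infty(q^{1/2}x^{-1})^n(q^{\lambda+\alpha_1};q)_n\sum_{k=0}^n\frac{(q^{\lambda+\alpha_1-h_1+l_1};q)_{n-k}}{(q;q)_k(q;q)_{n-k}}(q^{l_1}t_1)^k(q^{l_2}t_2)^{n-k}$$ are formal solutions of $$(x-q^{l_1-1/2}t_1)(x-q^{l_2-1/2}t_2)g(qx)-q^{-h_1+l_1+l_2+2\lambda-1/2}t_2(x-q^{h_1+1/2}t_1)g(x/q)$$ $$-\big[q^{-\alpha_1}x^2-q^{l_1+l_2+\lambda-1/2}\{q^{-l_2}t_1+(q^{-h_1}+q^{-l_1})t_2\}x+q^{l_1+l_2+\lambda}(1+q^{-1})t_1t_2\big]g(x)=0.$$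
   Context: Conventions: $q\in\mathbb{C}$, $0<|q|<1$, with a fixed choice of $\log q$, and $q^a=\exp(a\log q)$. $(\lambda;q)_n=\prod_{j=0}^{n-1}(1-\lambda q^j)$, $(z;q)_\infty=\prod_{i=0}^\infty(1-q^iz)$. Formal solutions: convergence of the series is not considered. For $\mu\in\mathbb{C}$, $x^\mu$ is a symbol with $(q^{\pm1}x)^\mu=q^{\pm\mu}x^\mu$. An expression $P(x)\,x^\mu\sum_{n\ge0}a_nx^{-n}$, where $P(x)$ is $1$ or a product of factors $(\beta x;q)_\infty^{\pm1}$, is a formal solution of a $q$-difference equation if, after termwise substitution and use of $(\beta qx;q)_\infty=(\beta x;q)_\infty/(1-\beta x)$ and $(\beta x/q;q)_\infty=(1-\beta x/q)(\beta x;q)_\infty$ to factor out $P(x)$ (the rational factors produced combining with the polynomial coefficients of the equation), the coefficient of every power of $x$ in the remaining formal series $x^{\mu+2}\sum_{m\ge0}b_mx^{-m}$ is zero. *)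

theory Defs
  imports Complex_Main "HOL-Computational_Algebra.Computational_Algebra"
begin

text \<open>The parameter \<open>logq\<close> is the chosen value of \<open>log q\<close>, so \<open>q = exp logq = qpow logq 1\<close>.\<close>

definition qpow :: "complex \<Rightarrow> complex \<Rightarrow> complex" where
  "qpow logq a = exp (a * logq)"

definition qpoch :: "complex \<Rightarrow> complex \<Rightarrow> nat \<Rightarrow> complex" where
  "qpoch q a n = (\<Prod>j<n. 1 - a * q ^ j)"

text \<open>
  \<open>Formal_Expr bs cs \<mu> a\<close> stands for the formal expression
  \<open>(\<Prod>b\<leftarrow>bs. (b x; q)\<^sub>\<infinity>) * (\<Prod>c\<leftarrow>cs. (c x; q)\<^sub>\<infinity>)\<^sup>-\<^sup>1 * x\<^sup>\<mu> * (\<Sum>n. a\<^sub>n x\<^sup>-\<^sup>n)\<close>.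
  The infinite products and \<open>x\<^sup>\<mu>\<close> are symbols, known only through their behaviour under
  \<open>x \<mapsto> q x\<close> and \<open>x \<mapsto> x / q\<close>; the variable of the power series is \<open>1 / x\<close>.
\<close>

datatype formal_expr =
  Formal_Expr (num_factors: "complex list") (den_factors: "complex list")
    (exponent: complex) (series: "complex fps")

text \<open>
  Polynomials in \<open>x\<close>, and the rational functions obtained from them, live in the field of formal
  Laurent series in \<open>1 / x\<close>. Thus \<open>x\<close> is \<open>fls_X_inv\<close>, and rational functions are expanded
  at infinity if they are not polynomials.
\<close>

definition poly_in_x :: "complex poly \<Rightarrow> complex fls" where
  "poly_in_x p = poly (map_poly fls_const p) fls_X_inv"

text \<open>
  \<open>g(q x)\<close>, \<open>g(x / q)\<close> and \<open>g(x)\<close>, each divided by the factor \<open>P(x) x\<^sup>\<mu>\<close> of \<open>g(x)\<close>. The first two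
  use \<open>(b q x; q)\<^sub>\<infinity> = (b x; q)\<^sub>\<infinity> / (1 - b x)\<close> and \<open>(b x / q; q)\<^sub>\<infinity> = (1 - b x / q) (b x; q)\<^sub>\<infinity>\<close>.
\<close>

definition shift_up :: "complex \<Rightarrow> formal_expr \<Rightarrow> complex fls" where
  "shift_up logq g = (let q = qpow logq 1 in
     (\<Prod>c\<leftarrow>den_factors g. poly_in_x [:1, - c:]) / (\<Prod>b\<leftarrow>num_factors g. poly_in_x [:1, - b:])
     * fls_const (qpow logq (exponent g))
     * fps_to_fls (fps_compose (series g) (fps_const (1 / q) * fps_X)))"

definition shift_down :: "complex \<Rightarrow> formal_expr \<Rightarrow> complex fls" where
  "shift_down logq g = (let q = qpow logq 1 in
     (\<Prod>b\<leftarrow>num_factors g. poly_in_x [:1, - (b / q):]) / (\<Prod>c\<leftarrow>den_factors g. poly_in_x [:1, - (c / q):])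
     * fls_const (qpow logq (- exponent g))
     * fps_to_fls (fps_compose (series g) (fps_const q * fps_X)))"

definition no_shift :: "formal_expr \<Rightarrow> complex fls" where
  "no_shift g = fps_to_fls (series g)"

text \<open>\<open>g\<close> formally solves \<open>A(x) g(q x) + B(x) g(x / q) - C(x) g(x) = 0\<close>.\<close>

definition formal_solution ::
  "complex \<Rightarrow> complex poly \<Rightarrow> complex poly \<Rightarrow> complex poly \<Rightarrow> formal_expr \<Rightarrow> bool" where
  "formal_solution logq A B C g \<longleftrightarrow>
     poly_in_x A * shift_up logq g + poly_in_x B * shift_down logq g - poly_in_x C * no_shift g = 0"

end

theory Submission
  imports Defs
begin

text \<open>
  The inner sums are coefficients of Cauchy products of \<open>q\<close>-binomial series: up to the factor
  \<open>q\<^bsup>-n(n-1)/2\<^esup>\<close>, those of \<open>g\<^sub>1\<close> and \<open>g\<^sub>3\<close> come from the product with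
  \<open>\<Sum>\<^sub>m q\<^bsup>m(m-1)/2\<^esup> z\<^sup>m / (q;q)\<^sub>m\<close>, because
  \<open>l(2n-l-1)/2 = n(n-1)/2 - (n-l)(n-l-1)/2\<close>. Each factor satisfies a first-order \<open>q\<close>-difference
  equation in \<open>z\<close>, so the product does too, and comparing coefficients gives a three-term
  recurrence for the inner sums. After the infinite product \<open>P(x)\<close> has been absorbed into the
  polynomial coefficients, this is, up to a factor \<open>s(q\<^sup>n)\<close>, the recurrence that the equation
  imposes on the coefficients of the series.
\<close>

section \<open>Powers of \<open>q\<close> and q-Pochhammer symbols\<close>

lemma qpow_add: "qpow c (a + b) = qpow c a * qpow c b"
  by (simp add: qpow_def mult_exp_exp distrib_right)

lemma qpow_minus: "qpow c (- a) = inverse (qpow c a)"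
  by (simp add: qpow_def exp_minus)

lemma qpow_diff: "qpow c (a - b) = qpow c a / qpow c b"
  by (simp add: qpow_def exp_diff left_diff_distrib)

lemma qpow_nonzero [simp]: "qpow c a \<noteq> 0"
  by (simp add: qpow_def)

lemma qpow_double: "qpow c (2 * a) = qpow c a ^ 2"
  unfolding mult_2 qpow_add power2_eq_square ..

lemma qpow_of_nat: "qpow c (of_nat n) = qpow c 1 ^ n"
  by (simp add: qpow_def flip: exp_of_nat_mult)

lemma qpow_half_square: "qpow c (1/2) ^ 2 = qpow c 1"
  unfolding qpow_double [symmetric] by simp

lemma qpoch_Suc: "qpoch q a (Suc n) = qpoch q a n * (1 - a * q ^ n)"
  by (simp add: qpoch_def)

lemma qpoch_zero [simp]: "qpoch q 0 n = 1"
  by (simp add: qpoch_def)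

lemma qpoch_0_right [simp]: "qpoch q a 0 = 1"
  by (simp add: qpoch_def)

lemma one_minus_power_nonzero:
  fixes q :: complex
  assumes "norm q < 1"
  shows "1 - q * q ^ n \<noteq> 0"
proof -
  have "norm (q * q ^ n) < 1"
    using assms power_le_one[of "norm q" n] mult_left_mono[of "norm q ^ n" 1 "norm q"]
    by (simp add: norm_mult norm_power)
  then show ?thesis
    by force
qed

lemma qpoch_self_nonzero:
  assumes "norm q < 1"
  shows "qpoch q q n \<noteq> 0"
  using one_minus_power_nonzero[OF assms] by (simp add: qpoch_def)

section \<open>q-binomial series and their q-difference equations\<close>

definition fps_dilate :: "complex \<Rightarrow> complex fps \<Rightarrow> complex fps" where
  "fps_dilate q f = fps_compose f (fps_const q * fps_X)"

lemma fps_dilate_nth [simp]: "fps_nth (fps_dilate q f) n = q ^ n * fps_nth f n"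
  by (simp add: fps_dilate_def fps_nth_compose_linear)

lemma fps_dilate_mult: "fps_dilate q (f * g) = fps_dilate q f * fps_dilate q g"
  by (simp add: fps_dilate_def fps_compose_mult_distrib)

text \<open>By the q-binomial theorem this is the expansion in z of
  \<open>(\<beta> T z; q)_\<infinity> / (T z; q)_\<infinity>\<close>; for \<beta> = 0 it is Euler's
  series for \<open>1 / (T z; q)_\<infinity>\<close>.\<close>

definition qbinomial_fps :: "complex \<Rightarrow> complex \<Rightarrow> complex \<Rightarrow> complex fps" where
  "qbinomial_fps q \<beta> T = Abs_fps (\<lambda>k. qpoch q \<beta> k / qpoch q q k * T ^ k)"

text \<open>In the product form, passing from z to qz drops the first factor above and below the
  fraction bar. For coefficients this is the ratio
  \<open>(1 - \<beta> q^m) T / (1 - q^(m+1))\<close> of consecutive terms.\<close>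

lemma qbinomial_fps_dilate:
  assumes "norm q < 1"
  shows "(1 - fps_const (\<beta> * T) * fps_X) * fps_dilate q (qbinomial_fps q \<beta> T)
         = (1 - fps_const T * fps_X) * qbinomial_fps q \<beta> T"
proof (rule fps_ext)
  fix n
  show "fps_nth ((1 - fps_const (\<beta> * T) * fps_X) * fps_dilate q (qbinomial_fps q \<beta> T)) n
      = fps_nth ((1 - fps_const T * fps_X) * qbinomial_fps q \<beta> T) n"
  proof (cases n)
    case 0
    then show ?thesis by (simp add: qbinomial_fps_def)
  next
    case (Suc m)
    show ?thesis
      using qpoch_self_nonzero[OF assms, of m] one_minus_power_nonzero[OF assms, of m]
      by (simp add: Suc qbinomial_fps_def qpoch_Suc left_diff_distrib mult.assoc)
         (simp add: field_simps)
  qed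
qed

text \<open>Euler's expansion of \<open>(- z; q)_\<infinity>\<close>.\<close>

definition qexp_fps :: "complex \<Rightarrow> complex fps" where
  "qexp_fps q = Abs_fps (\<lambda>m. q ^ (m choose 2) / qpoch q q m)"

lemma Suc_choose_two: "Suc n choose 2 = n + (n choose 2)"
  by (simp add: numeral_2_eq_2)

lemma qexp_fps_dilate:
  assumes "norm q < 1"
  shows "(1 + fps_X) * fps_dilate q (qexp_fps q) = qexp_fps q"
proof (rule fps_ext)
  fix n
  show "fps_nth ((1 + fps_X) * fps_dilate q (qexp_fps q)) n = fps_nth (qexp_fps q) n"
  proof (cases n)
    case 0
    then show ?thesis by (simp add: qexp_fps_def)
  next
    case (Suc m)
    show ?thesis
      using qpoch_self_nonzero[OF assms, of m] one_minus_power_nonzero[OF assms, of m]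
      by (simp add: Suc qexp_fps_def qpoch_Suc distrib_right Suc_choose_two power_add)
         (simp add: field_simps)
  qed
qed

section \<open>Three-term recurrences for the inner sums\<close>

lemma of_nat_choose_two: "(of_nat (n choose 2) :: complex) = of_nat n * (of_nat n - 1) / 2"
  by (induction n) (simp_all add: Suc_choose_two field_simps)

lemma qpow_triangular:
  assumes "l \<le> n"
  shows "qpow c (- (of_nat l * (2 * of_nat n - of_nat l - 1) / 2))
         = qpow c 1 ^ ((n - l) choose 2) / qpow c 1 ^ (n choose 2)"
proof -
  have "- (of_nat l * (2 * of_nat n - of_nat l - 1) / 2)
        = (of_nat ((n - l) choose 2) - of_nat (n choose 2) :: complex)"
    using assms by (simp add: of_nat_choose_two of_nat_diff field_simps)
  then show ?thesis
    by (simp add: qpow_diff qpow_of_nat)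
qed

lemma qbinomial_product_recurrence:
  fixes q \<beta> T1 T2 :: complex
  assumes "norm q < 1"
  defines "S \<equiv> \<lambda>n. \<Sum>k=0..n. qpoch q \<beta> (n - k) / (qpoch q q k * qpoch q q (n - k))
                           * T1 ^ k * T2 ^ (n - k)"
  shows "(1 - q) * S 1 = (T1 + T2 - \<beta> * T2) * S 0"
    and "(1 - q ^ (n + 2)) * S (n + 2)
         = (T1 + T2 - \<beta> * T2 * q ^ (n + 1)) * S (n + 1) - T1 * T2 * S n"
proof -
  define F where "F = qbinomial_fps q 0 T1 * qbinomial_fps q \<beta> T2"
  have nth: "fps_nth F n = S n" for n
    unfolding F_def S_def fps_mult_nth
    by (intro sum.cong) (auto simp: qbinomial_fps_def field_simps)
  \<comment> \<open>The trivial factor with \<open>0 * T1\<close> brings the first series into the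
    shape of the dilation equation at \<beta> = 0.\<close>
  have "(1 - fps_const (\<beta> * T2) * fps_X) * fps_dilate q F
      = ((1 - fps_const (0 * T1) * fps_X) * fps_dilate q (qbinomial_fps q 0 T1))
        * ((1 - fps_const (\<beta> * T2) * fps_X) * fps_dilate q (qbinomial_fps q \<beta> T2))"
    by (simp add: F_def fps_dilate_mult algebra_simps)
  also have "\<dots> = (1 - fps_const T1 * fps_X) * ((1 - fps_const T2 * fps_X) * F)"
    unfolding qbinomial_fps_dilate[OF assms(1)] F_def by (simp add: algebra_simps)
  finally have eq: "fps_nth ((1 - fps_const (\<beta> * T2) * fps_X) * fps_dilate q F) n
      = fps_nth ((1 - fps_const T1 * fps_X) * ((1 - fps_const T2 * fps_X) * F)) n" for n
    by simp
  \<comment> \<open>Degree 1 has to be treated apart because the general recurrence starts in degree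
    2; it is the case n = -1 with the missing term S(-1) read as 0.\<close>
  show "(1 - q) * S 1 = (T1 + T2 - \<beta> * T2) * S 0"
    using eq[of 1] by (simp add: left_diff_distrib mult.assoc nth) (simp add: algebra_simps)
  show "(1 - q ^ (n + 2)) * S (n + 2)
         = (T1 + T2 - \<beta> * T2 * q ^ (n + 1)) * S (n + 1) - T1 * T2 * S n"
    using eq[of "Suc (Suc n)"] by (simp add: left_diff_distrib mult.assoc nth) (simp add: algebra_simps)
qed

lemma qexp_qbinomial_product_recurrence:
  fixes c q \<beta> T :: complex
  assumes q_def: "q = qpow c 1" and q: "norm q < 1"
  defines "S \<equiv> \<lambda>n. \<Sum>l=0..n. qpoch q \<beta> l / (qpoch q q (n - l) * qpoch q q l)
                * qpow c (- (of_nat l * (2 * of_nat n - of_nat l - 1) / 2)) * T ^ l"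
  shows "(1 - q) * S 1 = (T + 1 - \<beta> * T) * S 0"
    and "(1 - q ^ (n + 2)) * S (n + 2)
         = (T / q ^ (n + 1) + 1 - \<beta> * T) * S (n + 1) - \<beta> * T / q ^ (n + 1) * S n"
proof -
  have [simp]: "q \<noteq> 0"
    by (simp add: q_def)
  define F where "F = qbinomial_fps q \<beta> T * qexp_fps q"
  have nth: "fps_nth F n = q ^ (n choose 2) * S n" for n
    unfolding F_def S_def fps_mult_nth sum_distrib_left
    by (intro sum.cong refl)
       (simp add: qbinomial_fps_def qexp_fps_def qpow_triangular q_def [symmetric], simp add: mult_ac)
  have "(1 + fps_X) * ((1 - fps_const (\<beta> * T) * fps_X) * fps_dilate q F)
      = ((1 - fps_const (\<beta> * T) * fps_X) * fps_dilate q (qbinomial_fps q \<beta> T))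
        * ((1 + fps_X) * fps_dilate q (qexp_fps q))"
    by (simp add: F_def fps_dilate_mult algebra_simps)
  also have "\<dots> = (1 - fps_const T * fps_X) * F"
    unfolding qbinomial_fps_dilate[OF q] qexp_fps_dilate[OF q] F_def
    by (simp add: algebra_simps)
  finally have eq: "fps_nth ((1 + fps_X) * ((1 - fps_const (\<beta> * T) * fps_X) * fps_dilate q F)) n
      = fps_nth ((1 - fps_const T * fps_X) * F) n" for n
    by simp
  show "(1 - q) * S 1 = (T + 1 - \<beta> * T) * S 0"
    using eq[of 1] by (simp add: left_diff_distrib distrib_right mult.assoc nth)
      (simp add: binomial_eq_0 algebra_simps)
  let ?V = "fps_nth F"
  have "q ^ (n + 2) * ?V (n + 2) + (1 - \<beta> * T) * (q ^ (n + 1) * ?V (n + 1)) - \<beta> * T * (q ^ n * ?V n)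
      = ?V (n + 2) - T * ?V (n + 1)"
    using eq[of "Suc (Suc n)"]
    by (simp add: left_diff_distrib distrib_right mult.assoc) (simp add: algebra_simps)
  then have V: "(1 - q ^ (n + 2)) * ?V (n + 2)
      = (T + (1 - \<beta> * T) * q ^ (n + 1)) * ?V (n + 1) - \<beta> * T * q ^ n * ?V n"
    by (simp add: algebra_simps)
  \<comment> \<open>The exponents \<open>n choose 2\<close> grow by n and then by n + 1. Thus V(n+2)
    carries a factor \<open>q ^ (n + 1)\<close> that V(n+1) lacks, and dividing by it creates the
    negative powers of \<open>q\<close> in the recurrence.\<close>
  have V2: "?V (n + 2) = q ^ (n choose 2) * q ^ n * q ^ (n + 1) * S (n + 2)"
    and V1: "?V (n + 1) = q ^ (n choose 2) * q ^ n * S (n + 1)"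
    and V0: "?V n = q ^ (n choose 2) * S n"
    by (simp_all add: nth Suc_choose_two power_add)
  define x where "x = q ^ (n + 1)"
  define c where "c = q ^ (n choose 2) * q ^ n"
  have nz: "c \<noteq> 0" "x \<noteq> 0"
    by (simp_all add: c_def x_def)
  have "c * (x * ((1 - q ^ (n + 2)) * S (n + 2)))
      = c * ((T + (1 - \<beta> * T) * x) * S (n + 1) - \<beta> * T * S n)"
  proof -
    have "c * (x * ((1 - q ^ (n + 2)) * S (n + 2))) = (1 - q ^ (n + 2)) * ?V (n + 2)"
      unfolding V2 c_def x_def by (simp only: ac_simps)
    also have "\<dots> = c * ((T + (1 - \<beta> * T) * x) * S (n + 1) - \<beta> * T * S n)"
      unfolding V V1 V0 c_def x_def by (simp only: right_diff_distrib ac_simps)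
    finally show ?thesis .
  qed
  then have "x * ((1 - q ^ (n + 2)) * S (n + 2)) = (T + (1 - \<beta> * T) * x) * S (n + 1) - \<beta> * T * S n"
    using nz by simp
  then show "(1 - q ^ (n + 2)) * S (n + 2)
         = (T / q ^ (n + 1) + 1 - \<beta> * T) * S (n + 1) - \<beta> * T / q ^ (n + 1) * S n"
    unfolding x_def [symmetric] using nz by (simp add: divide_simps) (simp add: algebra_simps)
qed

section \<open>Polynomials in x as Laurent series in 1/x\<close>

lemma poly_in_x_pCons: "poly_in_x (pCons a p) = fls_const a + fls_X_inv * poly_in_x p"
  by (simp add: poly_in_x_def map_poly_pCons)

lemma poly_in_x_0 [simp]: "poly_in_x 0 = 0"
  by (simp add: poly_in_x_def)

lemma poly_in_x_add: "poly_in_x (p + r) = poly_in_x p + poly_in_x r"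
proof (induction p arbitrary: r)
  case (pCons a p)
  then show ?case
    by (cases r) (simp add: poly_in_x_pCons algebra_simps fls_plus_const [symmetric])
qed simp

lemma poly_in_x_smult: "poly_in_x (smult a p) = fls_const a * poly_in_x p"
  by (induction p) (simp_all add: poly_in_x_pCons distrib_left mult.left_commute)

lemma poly_in_x_mult: "poly_in_x (p * r) = poly_in_x p * poly_in_x r"
  by (induction p) (simp_all add: poly_in_x_pCons poly_in_x_add poly_in_x_smult distrib_right mult.assoc)

lemma poly_in_x_one_nonzero: "poly_in_x [:1, c:] \<noteq> 0"
proof
  assume "poly_in_x [:1, c:] = 0"
  then have "fls_nth (poly_in_x [:1, c:]) 0 = 0"
    by simp
  then show False
    by (simp add: poly_in_x_pCons fls_X_inv_times_conv_shift)
qed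

text \<open>Pulling out x^2 reverses the coefficients and leaves a power series in 1/x, so that an
  equation with quadratic coefficients becomes an identity between formal power series.\<close>

lemma poly_in_x_quadratic:
  "poly_in_x [:a0, a1, a2:]
   = fls_X_inv ^ 2 * fps_to_fls (fps_const a2 + fps_const a1 * fps_X + fps_const a0 * fps_X ^ 2)"
proof -
  have *: "i\<^sup>2 * (c2 + c1 * x + c0 * x\<^sup>2) = c0 + i * (c1 + i * c2)"
    if "i * x = 1" for i x c0 c1 c2 :: "complex fls"
  proof -
    have "i\<^sup>2 * (c2 + c1 * x + c0 * x\<^sup>2) = c0 * (i * x)\<^sup>2 + i * (c1 * (i * x) + i * c2)"
      by (simp add: power2_eq_square algebra_simps)
    then show ?thesis
      by (simp add: that)
  qed
  have "fls_X_inv * fls_X = (1 :: complex fls)"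
    by (simp add: fls_X_inv_times_conv_shift fls_X_conv_shift_1)
  from *[OF this, of "fls_const a2" "fls_const a1" "fls_const a0"] show ?thesis
    by (simp add: poly_in_x_pCons fls_times_fps_to_fls power2_eq_square)
qed

section \<open>Absorbing an infinite product into the polynomial coefficients\<close>

text \<open>For \<open>P(x) = 1 / (c x; q)_\<infinity>\<close>, the shift to qx multiplies by 1 - cx
  and the shift to x/q divides by 1 - cx/q. If \<open>B\<close> contains the latter factor, the
  division cancels and the equation left for the bare series is again polynomial.\<close>

lemma formal_solution_den_factor:
  assumes "B = B' * [:1, - (c / qpow logq 1):]"
  shows "formal_solution logq A B C (Formal_Expr [] [c] \<mu> a)
         \<longleftrightarrow> formal_solution logq (A * [:1, - c:]) B' C (Formal_Expr [] [] \<mu> a)"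
  using poly_in_x_one_nonzero[of "- (c / qpow logq 1)"]
  unfolding formal_solution_def shift_up_def shift_down_def no_shift_def assms poly_in_x_mult Let_def
  by (simp add: mult.assoc)

text \<open>Mirror image of the previous case: now the shift to qx produces the denominator 1 - cx,
  which has to divide \<open>A\<close>.\<close>

lemma formal_solution_num_factor:
  assumes "A = A' * [:1, - c:]"
  shows "formal_solution logq A B C (Formal_Expr [c] [] \<mu> a)
         \<longleftrightarrow> formal_solution logq A' (B * [:1, - (c / qpow logq 1):]) C (Formal_Expr [] [] \<mu> a)"
proof -
  define F where "F = poly_in_x [:1, - c:]"
  have "F \<noteq> 0"
    unfolding F_def by (rule poly_in_x_one_nonzero)
  then show ?thesis
    unfolding formal_solution_def shift_up_def shift_down_def no_shift_def assms poly_in_x_mult Let_def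
    by (simp add: F_def [symmetric] mult.assoc)
qed

section \<open>From coefficient recurrences to formal solutions\<close>

lemma formal_solution_recurrence:
  fixes logq q \<mu> M A0 A1 A2 B0 B1 B2 C0 C1 C2 :: complex and a :: "nat \<Rightarrow> complex"
  assumes q_def: "q = qpow logq 1" and M_def: "M = qpow logq \<mu>"
    and a1: "(1 - q) * a 1 = u 1 * a 0"
    and a2: "\<And>n. (1 - q ^ (n + 2)) * a (n + 2) = u (q ^ (n + 1)) * a (n + 1) + v (q ^ n) * a n"
    \<comment> \<open>\<open>y\<close> stands for \<open>q ^ n\<close>; a common factor \<open>s\<close> relates the two recurrences.\<close>
    and e2: "\<And>y. y \<noteq> 0 \<Longrightarrow> A2 * M / y + B2 * y / M - C2 = s y * (1 - y)"
    and e1: "\<And>y. y \<noteq> 0 \<Longrightarrow> A1 * M / y + B1 * y / M - C1 = - s (q * y) * u y"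
    and e0: "\<And>y. y \<noteq> 0 \<Longrightarrow> A0 * M / y + B0 * y / M - C0 = - s (q ^ 2 * y) * v y"
  shows "formal_solution logq [:A0, A1, A2:] [:B0, B1, B2:] [:C0, C1, C2:]
           (Formal_Expr [] [] \<mu> (Abs_fps a))"
proof -
  have [simp]: "q \<noteq> 0"
    by (simp add: q_def)
  let ?Q = "\<lambda>c0 c1 c2. fps_const c2 + fps_const c1 * fps_X + fps_const c0 * fps_X ^ 2"
  \<comment> \<open>The left-hand side of the equation divided by x^(\<mu>+2), as a power series in
    1/x.\<close>
  define \<Phi> where "\<Phi> = ?Q A0 A1 A2 * (fps_const M * fps_dilate (1 / q) (Abs_fps a))
    + ?Q B0 B1 B2 * (fps_const (1 / M) * fps_dilate q (Abs_fps a)) - ?Q C0 C1 C2 * Abs_fps a"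
  have coeff: "fps_nth (?Q c0 c1 c2 * (fps_const d * f)) n = d * (c2 * fps_nth f n
      + (if n \<ge> 1 then c1 * fps_nth f (n - 1) else 0)
      + (if n \<ge> 2 then c0 * fps_nth f (n - 2) else 0))" for c0 c1 c2 d :: complex and f n
  proof -
    have "?Q c0 c1 c2 * (fps_const d * f) = fps_const d
      * (fps_const c2 * f + fps_const c1 * (fps_X * f) + fps_const c0 * (fps_X ^ 2 * f))"
      by (simp add: algebra_simps)
    then show ?thesis
      by (simp only:) (simp add: fps_X_power_mult_nth)
  qed
  define E where "E = (\<lambda>c1 c2 c3 y. c1 * M / y + c2 * y / M - c3)"
  have e: "E A2 B2 C2 y = s y * (1 - y)" "E A1 B1 C1 y = - s (q * y) * u y"
      "E A0 B0 C0 y = - s (q ^ 2 * y) * v y" if "y \<noteq> 0" for y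
    using e2[OF that] e1[OF that] e0[OF that] by (simp_all add: E_def)
  have "\<Phi> = 0"
  proof (rule fps_ext)
    fix n
    have *: "fps_nth \<Phi> n = E A2 B2 C2 (q ^ n) * a n
      + (if n \<ge> 1 then E A1 B1 C1 (q ^ (n - 1)) * a (n - 1) else 0)
      + (if n \<ge> 2 then E A0 B0 C0 (q ^ (n - 2)) * a (n - 2) else 0)"
    proof -
      \<comment> \<open>The factor \<open>fps_const 1\<close> lets \<open>coeff\<close> apply to the
        third product as well.\<close>
      have "fps_nth \<Phi> n = fps_nth (?Q A0 A1 A2 * (fps_const M * fps_dilate (1 / q) (Abs_fps a))) n
        + fps_nth (?Q B0 B1 B2 * (fps_const (1 / M) * fps_dilate q (Abs_fps a))) n
        - fps_nth (?Q C0 C1 C2 * (fps_const 1 * Abs_fps a)) n"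
        by (simp add: \<Phi>_def)
      also have "\<dots> = E A2 B2 C2 (q ^ n) * a n
        + (if n \<ge> 1 then E A1 B1 C1 (q ^ (n - 1)) * a (n - 1) else 0)
        + (if n \<ge> 2 then E A0 B0 C0 (q ^ (n - 2)) * a (n - 2) else 0)"
        unfolding coeff by (simp add: E_def power_divide, simp add: algebra_simps add_divide_distrib)
      finally show ?thesis .
    qed
    consider "n = 0" | "n = 1" | m where "n = m + 2"
      by (metis One_nat_def add_2_eq_Suc' not0_implies_Suc)
    then show "fps_nth \<Phi> n = fps_nth 0 n"
    proof cases
      case 1
      then show ?thesis
        unfolding * by (simp add: e)
    next
      case 2
      have "fps_nth \<Phi> n = s q * ((1 - q) * a 1 - u 1 * a 0)"
        unfolding * by (simp add: 2 e algebra_simps)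
      then show ?thesis
        unfolding a1 by simp
    next
      case (3 m)
      \<comment> \<open>The shifts \<open>q * y\<close> and \<open>q ^ 2 * y\<close> in the
        arguments of \<open>s\<close> compensate for the lower indices: with y = q^(m+1) and y =
        q^m, all three terms carry the same factor s(q^(m+2)).\<close>
      have "fps_nth \<Phi> n = s (q ^ (m + 2)) * ((1 - q ^ (m + 2)) * a (m + 2)
              - (u (q ^ (m + 1)) * a (m + 1) + v (q ^ m) * a m))"
        unfolding * by (simp add: 3 e algebra_simps power2_eq_square)
      then show ?thesis
        unfolding a2 by simp
    qed
  qed
  have M': "qpow logq (- \<mu>) = 1 / M"
    by (simp add: M_def qpow_minus field_simps)
  have "poly_in_x [:A0, A1, A2:] * shift_up logq (Formal_Expr [] [] \<mu> (Abs_fps a))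
      + poly_in_x [:B0, B1, B2:] * shift_down logq (Formal_Expr [] [] \<mu> (Abs_fps a))
      - poly_in_x [:C0, C1, C2:] * no_shift (Formal_Expr [] [] \<mu> (Abs_fps a))
      = fls_X_inv ^ 2 * fps_to_fls \<Phi>"
    unfolding poly_in_x_quadratic shift_up_def shift_down_def no_shift_def Let_def
      q_def [symmetric] fps_dilate_def [symmetric] \<Phi>_def
    by (simp add: M' M_def [symmetric] fls_times_fps_to_fls algebra_simps
             del: fls_const_mult_const)
  then show ?thesis
    unfolding formal_solution_def \<open>\<Phi> = 0\<close> by simp
qed

text \<open>Raising the index of the prefactor \<open>r ^ n * qpoch q \<gamma> n\<close> by one
  multiplies it by r (1 - \<gamma> q^n). Hence \<open>f\<close> acquires one such factor and
  \<open>g\<close> two consecutive ones.\<close>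

lemma twisted_recurrence:
  fixes q r \<gamma> :: complex and S :: "nat \<Rightarrow> complex"
  defines "a \<equiv> \<lambda>n. r ^ n * qpoch q \<gamma> n * S n"
  assumes "(1 - q) * S 1 = f 1 * S 0"
    and "\<And>n. (1 - q ^ (n + 2)) * S (n + 2) = f (q ^ (n + 1)) * S (n + 1) + g (q ^ n) * S n"
  shows "(1 - q) * a 1 = r * (1 - \<gamma> * 1) * f 1 * a 0"
    and "(1 - q ^ (n + 2)) * a (n + 2)
         = r * (1 - \<gamma> * q ^ (n + 1)) * f (q ^ (n + 1)) * a (n + 1)
           + r ^ 2 * (1 - \<gamma> * (q * q ^ n)) * (1 - \<gamma> * q ^ n) * g (q ^ n) * a n"
proof -
  have "(1 - q) * a 1 = r * (1 - \<gamma>) * ((1 - q) * S 1)"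
    by (simp add: a_def qpoch_Suc)
  then show "(1 - q) * a 1 = r * (1 - \<gamma> * 1) * f 1 * a 0"
    unfolding assms(2) by (simp add: a_def)
  have "(1 - q ^ (n + 2)) * a (n + 2) = r ^ (n + 2) * qpoch q \<gamma> n * (1 - \<gamma> * q ^ n)
          * (1 - \<gamma> * q ^ (n + 1)) * ((1 - q ^ (n + 2)) * S (n + 2))"
    by (simp add: a_def qpoch_Suc)
  then show "(1 - q ^ (n + 2)) * a (n + 2)
         = r * (1 - \<gamma> * q ^ (n + 1)) * f (q ^ (n + 1)) * a (n + 1)
           + r ^ 2 * (1 - \<gamma> * (q * q ^ n)) * (1 - \<gamma> * q ^ n) * g (q ^ n) * a n"
    unfolding assms(3) by (simp add: a_def qpoch_Suc algebra_simps power2_eq_square)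
qed

text \<open>Covers g2 and g4, whose inner sums are Cauchy products of two q-binomial series. What
  remains for each equation is three rational identities in y, one for each power of x in its
  coefficients.\<close>

lemma formal_solution_qbinomial_product:
  fixes logq q \<mu> M A0 A1 A2 B0 B1 B2 C0 C1 C2 r \<gamma> \<beta> T1 T2 :: complex
  assumes "q = qpow logq 1" and "M = qpow logq \<mu>" and "norm q < 1"
    and "\<And>y. y \<noteq> 0 \<Longrightarrow> A2 * M / y + B2 * y / M - C2 = s y * (1 - y)"
    and "\<And>y. y \<noteq> 0 \<Longrightarrow> A1 * M / y + B1 * y / M - C1
          = - s (q * y) * (r * (1 - \<gamma> * y) * (T1 + T2 - \<beta> * T2 * y))"
    and "\<And>y. y \<noteq> 0 \<Longrightarrow> A0 * M / y + B0 * y / M - C0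
          = - s (q ^ 2 * y) * (r ^ 2 * (1 - \<gamma> * (q * y)) * (1 - \<gamma> * y) * (- (T1 * T2)))"
  shows "formal_solution logq [:A0, A1, A2:] [:B0, B1, B2:] [:C0, C1, C2:]
           (Formal_Expr [] [] \<mu> (Abs_fps (\<lambda>n. r ^ n * qpoch q \<gamma> n
             * (\<Sum>k=0..n. qpoch q \<beta> (n - k) / (qpoch q q k * qpoch q q (n - k))
                  * T1 ^ k * T2 ^ (n - k)))))"
proof -
  define S where "S n = (\<Sum>k=0..n. qpoch q \<beta> (n - k) / (qpoch q q k * qpoch q q (n - k))
                     * T1 ^ k * T2 ^ (n - k))" for n
  define f where "f = (\<lambda>y. T1 + T2 - \<beta> * T2 * y)"
  define g where "g = (\<lambda>y::complex. - (T1 * T2))"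
  have "(1 - q) * S 1 = f 1 * S 0"
    and "\<And>n. (1 - q ^ (n + 2)) * S (n + 2) = f (q ^ (n + 1)) * S (n + 1) + g (q ^ n) * S n"
    using qbinomial_product_recurrence[OF assms(3), where \<beta> = \<beta> and ?T1.0 = T1 and ?T2.0 = T2,
        folded S_def]
    by (simp_all add: f_def g_def)
  note rec = twisted_recurrence[where f = f and g = g and r = r and \<gamma> = \<gamma>, OF this]
  show ?thesis
    unfolding S_def [symmetric]
    by (rule formal_solution_recurrence[where u = "\<lambda>y. r * (1 - \<gamma> * y) * f y"
          and v = "\<lambda>y. r ^ 2 * (1 - \<gamma> * (q * y)) * (1 - \<gamma> * y) * g y" and s = s,
          OF assms(1,2) rec])
       (use assms(4-6) in \<open>simp_all add: f_def g_def\<close>)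
qed

text \<open>The counterpart for g1 and g3, where the triangular power of \<open>q\<close> in the
  inner sum brings in terms with 1/y.\<close>

lemma formal_solution_qexp_qbinomial_product:
  fixes logq q \<mu> M A0 A1 A2 B0 B1 B2 C0 C1 C2 r \<gamma> \<beta> T :: complex
  assumes "q = qpow logq 1" and "M = qpow logq \<mu>" and "norm q < 1"
    and "\<And>y. y \<noteq> 0 \<Longrightarrow> A2 * M / y + B2 * y / M - C2 = s y * (1 - y)"
    and "\<And>y. y \<noteq> 0 \<Longrightarrow> A1 * M / y + B1 * y / M - C1
          = - s (q * y) * (r * (1 - \<gamma> * y) * (T / y + 1 - \<beta> * T))"
    and "\<And>y. y \<noteq> 0 \<Longrightarrow> A0 * M / y + B0 * y / M - C0
          = - s (q ^ 2 * y)
              * (r ^ 2 * (1 - \<gamma> * (q * y)) * (1 - \<gamma> * y) * (- (\<beta> * T / (q * y))))"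
  shows "formal_solution logq [:A0, A1, A2:] [:B0, B1, B2:] [:C0, C1, C2:]
           (Formal_Expr [] [] \<mu> (Abs_fps (\<lambda>n. r ^ n * qpoch q \<gamma> n
             * (\<Sum>l=0..n. qpoch q \<beta> l / (qpoch q q (n - l) * qpoch q q l)
                  * qpow logq (- (of_nat l * (2 * of_nat n - of_nat l - 1) / 2)) * T ^ l))))"
proof -
  define S where "S n = (\<Sum>l=0..n. qpoch q \<beta> l / (qpoch q q (n - l) * qpoch q q l)
        * qpow logq (- (of_nat l * (2 * of_nat n - of_nat l - 1) / 2)) * T ^ l)" for n
  define f where "f = (\<lambda>y. T / y + 1 - \<beta> * T)"
  define g where "g = (\<lambda>y::complex. - (\<beta> * T / (q * y)))"
  have "(1 - q) * S 1 = f 1 * S 0"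
    and "\<And>n. (1 - q ^ (n + 2)) * S (n + 2) = f (q ^ (n + 1)) * S (n + 1) + g (q ^ n) * S n"
    using qexp_qbinomial_product_recurrence[OF assms(1,3), where \<beta> = \<beta> and T = T, folded S_def]
    by (simp_all add: f_def g_def)
  note rec = twisted_recurrence[where f = f and g = g and r = r and \<gamma> = \<gamma>, OF this]
  show ?thesis
    unfolding S_def [symmetric]
    by (rule formal_solution_recurrence[where u = "\<lambda>y. r * (1 - \<gamma> * y) * f y"
          and v = "\<lambda>y. r ^ 2 * (1 - \<gamma> * (q * y)) * (1 - \<gamma> * y) * g y" and s = s,
          OF assms(1,2) rec])
       (use assms(4-6) in \<open>simp_all add: f_def g_def\<close>)
qed

section \<open>Verification for the four series\<close>

theorem proposition6p3:
  fixes q logq h1 h2 l1 l2 \<alpha>1 lam t1 t2 :: complex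
  assumes q: "0 < norm q" "norm q < 1"
    and logq: "exp logq = q"
    and t: "t1 \<noteq> 0" "t2 \<noteq> 0"
  shows
    "(let
        A = smult (qpow logq (h1 + h2 - l1 - 2 * lam + 1/2) * t2)
              [:qpow logq (l1 - 1/2) * t1, - 1:];
        B = [:- (qpow logq (h1 + 1/2) * t1), 1:] * [:- (qpow logq (h2 + 1/2) * t2), 1:];
        C = [:qpow logq (h1 + h2 - lam) * (q + 1) * t1 * t2,
              - (qpow logq (h1 + h2 - lam + 1/2)
                 * (qpow logq (- h2) * t1 + qpow logq (- h1) * t2 + qpow logq (- l1) * t2)),
              qpow logq \<alpha>1:];
        g1 = Formal_Expr [] [] (- \<alpha>1)
              (Abs_fps (\<lambda>n.
                 (qpow logq (- lam - \<alpha>1 + h1 + 1/2) * t1) ^ n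
                 * qpoch q (qpow logq (lam + \<alpha>1)) n
                 * (\<Sum>l=0..n. qpoch q (qpow logq (lam + \<alpha>1 - h1 + l1)) l
                      / (qpoch q q (n - l) * qpoch q q l)
                      * qpow logq (- (of_nat l * (2 * of_nat n - of_nat l - 1) / 2))
                      * (- qpow logq (- lam - \<alpha>1 - l1 + h2) * t2 / t1) ^ l)));
        g2 = Formal_Expr [] [qpow logq (- h2 + 1/2) * inverse t2]
              (2 * lam + \<alpha>1 - h1 + l1 - 1)
              (Abs_fps (\<lambda>n.
                 qpow logq (1/2) ^ n
                 * qpoch q (qpow logq (- lam - \<alpha>1 + h1 - l1 + 1)) n
                 * (\<Sum>k=0..n. qpoch q (qpow logq (- lam - \<alpha>1 + 1)) (n - k)
                      / (qpoch q q k * qpoch q q (n - k))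
                      * (qpow logq l1 * t1) ^ k * (qpow logq h2 * t2) ^ (n - k))))
      in formal_solution logq A B C g1 \<and> formal_solution logq A B C g2)
    \<and>
     (let
        A = [:- (qpow logq (l1 - 1/2) * t1), 1:] * [:- (qpow logq (l2 - 1/2) * t2), 1:];
        B = - smult (qpow logq (- h1 + l1 + l2 + 2 * lam - 1/2) * t2)
              [:- (qpow logq (h1 + 1/2) * t1), 1:];
        C = [:qpow logq (l1 + l2 + lam) * (1 + inverse q) * t1 * t2,
              - (qpow logq (l1 + l2 + lam - 1/2)
                 * (qpow logq (- l2) * t1 + (qpow logq (- h1) + qpow logq (- l1)) * t2)),
              qpow logq (- \<alpha>1):];
        g3 = Formal_Expr [qpow logq (- l2 + 1/2) * inverse t2] []
              (2 * lam + \<alpha>1 - h1 + l1 - 1)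
              (Abs_fps (\<lambda>n.
                 (qpow logq (lam + \<alpha>1 + l1 - 1/2) * t1) ^ n
                 * qpoch q (qpow logq (- lam - \<alpha>1 + h1 - l1 + 1)) n
                 * (\<Sum>l=0..n. qpoch q (qpow logq (- lam - \<alpha>1 + 1)) l
                      / (qpoch q q (n - l) * qpoch q q l)
                      * qpow logq (- (of_nat l * (2 * of_nat n - of_nat l - 1) / 2))
                      * (- qpow logq (lam + \<alpha>1 - h1 + l2 - 1) * t2 / t1) ^ l)));
        g4 = Formal_Expr [] [] (- \<alpha>1)
              (Abs_fps (\<lambda>n.
                 qpow logq (1/2) ^ n
                 * qpoch q (qpow logq (lam + \<alpha>1)) n
                 * (\<Sum>k=0..n. qpoch q (qpow logq (lam + \<alpha>1 - h1 + l1)) (n - k)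
                      / (qpoch q q k * qpoch q q (n - k))
                      * (qpow logq l1 * t1) ^ k * (qpow logq l2 * t2) ^ (n - k))))
      in formal_solution logq A B C g3 \<and> formal_solution logq A B C g4)"
proof -
  \<comment> \<open>Every power of \<open>q\<close> with a parameter in its exponent becomes a
    monomial in these nonzero quantities. Half-integer exponents make the square root
    \<open>R\<close> of \<open>q\<close> the basic variable, and the required conditions turn into
    rational identities.\<close>
  define R where "R = qpow logq (1/2)"
  define H1 where "H1 = qpow logq h1"
  define H2 where "H2 = qpow logq h2"
  define L1 where "L1 = qpow logq l1"
  define L2 where "L2 = qpow logq l2"
  define A where "A = qpow logq \<alpha>1"
  define \<Lambda> where "\<Lambda> = qpow logq lam"
  have [simp]: "R \<noteq> 0" "H1 \<noteq> 0" "H2 \<noteq> 0" "L1 \<noteq> 0" "L2 \<noteq> 0" "A \<noteq> 0" "\<Lambda> \<noteq> 0"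
    by (simp_all add: R_def H1_def H2_def L1_def L2_def A_def \<Lambda>_def)
  have qpow_1: "qpow logq 1 = q"
    by (simp add: qpow_def logq)
  have q_R: "q = R ^ 2"
    unfolding R_def qpow_half_square qpow_1 ..
  note qpow_simps = qpow_add qpow_diff qpow_minus qpow_double qpow_1 R_def [symmetric]
    H1_def [symmetric] H2_def [symmetric] L1_def [symmetric] L2_def [symmetric]
    A_def [symmetric] \<Lambda>_def [symmetric]
  note [simp] = t
  let ?a1 = "qpow logq (l1 - 1/2) * t1" and ?a2 = "qpow logq (l2 - 1/2) * t2"
    and ?b1 = "qpow logq (h1 + 1/2) * t1" and ?b2 = "qpow logq (h2 + 1/2) * t2"
    and ?K = "qpow logq (h1 + h2 - l1 - 2 * lam + 1/2) * t2"
    and ?K' = "qpow logq (- h1 + l1 + l2 + 2 * lam - 1/2) * t2"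
    and ?c2 = "qpow logq (- h2 + 1/2) * inverse t2"
    and ?c3 = "qpow logq (- l2 + 1/2) * inverse t2"
  show ?thesis
    unfolding Let_def
  proof (intro conjI, goal_cases)
    case 1
    \<comment> \<open>The zero leading coefficient pads the linear polynomial to the quadratic shape
      of the criterion.\<close>
    have A: "smult ?K [:?a1, - 1:] = [:?K * ?a1, - ?K, 0:]"
      by simp
    have B: "[:- ?b1, 1:] * [:- ?b2, 1:] = [:?b1 * ?b2, - ?b1 - ?b2, 1:]"
      by simp
    show ?case
      unfolding A B
      \<comment> \<open>In every case \<open>s\<close> is read off from the x^2 coefficients. Here
        \<open>M\<close> is 1/A, and A y - A = - A (1 - y).\<close>
      by (rule formal_solution_qexp_qbinomial_product
            [where q = q and s = "\<lambda>_. - A", OF qpow_1 [symmetric] refl q(2)])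
         (simp_all only: qpow_simps, unfold q_R, (simp add: field_simps power2_eq_square)+)
  next
    case 2
    \<comment> \<open>The number \<open>?c2 / q\<close> is the reciprocal of the root
      \<open>?b2\<close>, so the denominator produced by the infinite product divides
      \<open>B\<close>.\<close>
    have B: "[:- ?b1, 1:] * [:- ?b2, 1:] = [:?b1 * ?b2, - ?b2, 0:] * [:1, - (?c2 / qpow logq 1):]"
      unfolding qpow_simps q_R by (simp add: field_simps power2_eq_square)
    have A: "smult ?K [:?a1, - 1:] * [:1, - ?c2:] = [:?K * ?a1, - ?K * (1 + ?a1 * ?c2), ?K * ?c2:]"
      by (simp add: algebra_simps)
    show ?case
      unfolding formal_solution_den_factor[OF B] A
      \<comment> \<open>Here \<open>?K * ?c2\<close> times \<open>M\<close> is \<open>A\<close>, so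
        the x^2 coefficients give A/y - A = (A/y) (1 - y).\<close>
      by (rule formal_solution_qbinomial_product
            [where q = q and s = "\<lambda>y. A / y", OF qpow_1 [symmetric] refl q(2)])
         (simp_all only: qpow_simps, unfold q_R, (simp add: field_simps power2_eq_square)+)
  next
    case 3
    \<comment> \<open>This time \<open>?c3\<close> is the reciprocal of the root \<open>?a2\<close>
      of the coefficient of g(qx).\<close>
    have A: "[:- ?a1, 1:] * [:- ?a2, 1:] = [:?a1 * ?a2, - ?a2, 0:] * [:1, - ?c3:]"
      unfolding qpow_simps q_R by (simp add: field_simps power2_eq_square)
    have B: "- smult ?K' [:- ?b1, 1:] * [:1, - (?c3 / qpow logq 1):]
        = [:?K' * ?b1, - ?K' * (1 + ?b1 * (?c3 / qpow logq 1)), ?K' * (?c3 / qpow logq 1):]"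
      by (simp add: algebra_simps)
    show ?case
      unfolding formal_solution_num_factor[OF A] B
      by (rule formal_solution_qexp_qbinomial_product
            [where q = q and s = "\<lambda>_. - 1 / A", OF qpow_1 [symmetric] refl q(2)])
         (simp_all only: qpow_simps, unfold q_R, (simp add: field_simps power2_eq_square)+)
  next
    case 4
    have A: "[:- ?a1, 1:] * [:- ?a2, 1:] = [:?a1 * ?a2, - ?a1 - ?a2, 1:]"
      by simp
    have B: "- smult ?K' [:- ?b1, 1:] = [:?K' * ?b1, - ?K', 0:]"
      by simp
    show ?case
      unfolding A B
      by (rule formal_solution_qbinomial_product
            [where q = q and s = "\<lambda>y. 1 / (A * y)", OF qpow_1 [symmetric] refl q(2)])
         (simp_all only: qpow_simps, unfold q_R, (simp add: field_simps power2_eq_square)+)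
  qed
qed

end
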